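(* Let $S,O$ be sets, $\iota_S:S\to(0,\infty)$, $\iota_O:O\to(0,\infty)$ maps, and $c:S\times O\to[0,\infty)$, $c(s,o):=J(\iota_S(s)/\iota_O(o))$. Let $\mathcal C:S\times O\to\mathbb{R}$ be a certificate that is ordinally sound relative to $c$. Then for each $s\in S$ there exists a strictly increasing function $\phi_s:\mathrm{im}(c_s)\to\mathbb{R}$, where $c_s(o):=c(s,o)$, such that $$\mathcal C(s,o)=\phi_s(c(s,o))\qquad\text{for all }o\in O.$$ In particular, for each fixed $s$, $\mathcal C(s,\cdot)$ is a strictly monotone reparametrization of $c(s,\cdot)$.
   Context: $J(x):=\frac12(x+x^{-1})-1$ for $x>0$. $\mathcal C$ is ordinally sound relative to $c$ if for every $s\in S$ and all $o_1,o_2\in O$: $\mathcal C(s,o_1)\le\mathcal C(s,o_2)\iff c(s,o_1)\le c(s,o_2)$. It is assumed throughout that the sets $\arg\min_{o\in O}c(s,o)$ and $\arg\min_{o\in O}\mathcal C(s,o)$ are nonempty. *)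

theory Defs
  imports Complex_Main
begin

text \<open>Only the values at positive arguments matter.\<close>

definition J :: "real \<Rightarrow> real" where
  "J x = (x + inverse x) / 2 - 1"

definition ratio_cost :: "('s \<Rightarrow> real) \<Rightarrow> ('o \<Rightarrow> real) \<Rightarrow> 's \<Rightarrow> 'o \<Rightarrow> real" where
  "ratio_cost \<iota>\<^sub>S \<iota>\<^sub>O s x = J (\<iota>\<^sub>S s / \<iota>\<^sub>O x)"

lemma J_nonneg:
  assumes "x > 0"
  shows "J x \<ge> 0"
proof -
  have "J x = (x - 1)\<^sup>2 / (2 * x)"
    using assms by (simp add: J_def field_simps power2_eq_square)
  then show ?thesis
    using assms by simp
qed

text \<open>The cost takes values in \<open>[0, \<infinity>)\<close>, as its declared codomain requires.\<close>

lemma ratio_cost_nonneg: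
  assumes "\<iota>\<^sub>S s > 0" and "\<iota>\<^sub>O x > 0"
  shows "ratio_cost \<iota>\<^sub>S \<iota>\<^sub>O s x \<ge> 0"
  using assms by (simp add: ratio_cost_def J_nonneg)

definition ordinally_sound ::
  "'s set \<Rightarrow> 'o set \<Rightarrow> ('s \<Rightarrow> 'o \<Rightarrow> real) \<Rightarrow> ('s \<Rightarrow> 'o \<Rightarrow> real) \<Rightarrow> bool" where
  "ordinally_sound S Ob c C \<longleftrightarrow>
     (\<forall>s\<in>S. \<forall>o1\<in>Ob. \<forall>o2\<in>Ob. C s o1 \<le> C s o2 \<longleftrightarrow> c s o1 \<le> c s o2)"

end

theory Submission
  imports Defs
begin

text \<open>
  For a fixed \<open>s\<close> the functions \<open>c s\<close> and \<open>C s\<close> induce the same preorder on \<open>Ob\<close>. Both take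
  values in an antisymmetric order, so they have the same level sets, and \<open>C s\<close> therefore factors
  through \<open>c s\<close>: the value \<open>\<phi> t\<close> can be read off at any point where \<open>c s\<close> equals \<open>t\<close>.
  Strict inequality is determined by the weak one (below, but not above), so the factor is
  strictly increasing.
\<close>

text \<open>
  Antisymmetry in the codomain of \<open>g\<close> is what makes the factorization possible: points with
  equal \<open>f\<close>-value have \<open>g\<close>-values below each other in both directions, hence equal. So
  \<open>\<phi>\<close> may be defined by composing \<open>g\<close> with any right inverse of \<open>f\<close>.
\<close>

lemma order_equivalent_imp_strict_mono_factor:
  fixes f :: "'a \<Rightarrow> 'b::preorder" and g :: "'a \<Rightarrow> 'c::order"
  assumes le_iff: "\<And>x y. x \<in> A \<Longrightarrow> y \<in> A \<Longrightarrow> g x \<le> g y \<longleftrightarrow> f x \<le> f y"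
  obtains \<phi> where "strict_mono_on (f ` A) \<phi>" and "\<And>x. x \<in> A \<Longrightarrow> g x = \<phi> (f x)"
proof -
  define \<phi> where "\<phi> t = g (inv_into A f t)" for t
  have factor: "g x = \<phi> (f x)" if "x \<in> A" for x
  proof -
    have "inv_into A f (f x) \<in> A" and "f (inv_into A f (f x)) = f x"
      using that by (simp_all add: inv_into_into f_inv_into_f)
    \<comment> \<open>The chosen preimage may differ from \<open>x\<close>, but it lies in the same level set of \<open>f\<close>.\<close>
    with that show ?thesis
      unfolding \<phi>_def by (intro order.antisym) (simp_all add: le_iff)
  qed
  have "strict_mono_on (f ` A) \<phi>"
  proof (rule strict_mono_onI)
    fix t u assume "t \<in> f ` A" "u \<in> f ` A" "t < u"
    then obtain x y where "x \<in> A" "y \<in> A" and tu: "t = f x" "u = f y" and "f x < f y"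
      by blast
    then have "g x < g y"
      by (simp add: less_le_not_le le_iff)
    then show "\<phi> t < \<phi> u"
      using \<open>x \<in> A\<close> \<open>y \<in> A\<close> by (simp add: tu factor)
  qed
  with factor show thesis
    using that by blast
qed

theorem lemma3p25:
  fixes S :: "'s set" and Ob :: "'o set"
    and \<iota>\<^sub>S :: "'s \<Rightarrow> real" and \<iota>\<^sub>O :: "'o \<Rightarrow> real"
    and c C :: "'s \<Rightarrow> 'o \<Rightarrow> real"
  assumes "\<And>s. s \<in> S \<Longrightarrow> \<iota>\<^sub>S s > 0"
    and "\<And>x. x \<in> Ob \<Longrightarrow> \<iota>\<^sub>O x > 0"
    and "\<And>s x. s \<in> S \<Longrightarrow> x \<in> Ob \<Longrightarrow> c s x = ratio_cost \<iota>\<^sub>S \<iota>\<^sub>O s x"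
    and "\<And>s. s \<in> S \<Longrightarrow> {x. is_arg_min (c s) (\<lambda>y. y \<in> Ob) x} \<noteq> {}"
    and "\<And>s. s \<in> S \<Longrightarrow> {x. is_arg_min (C s) (\<lambda>y. y \<in> Ob) x} \<noteq> {}"
    and "ordinally_sound S Ob c C"
  shows "\<forall>s\<in>S. \<exists>\<phi> :: real \<Rightarrow> real.
           strict_mono_on (c s ` Ob) \<phi> \<and> (\<forall>x\<in>Ob. C s x = \<phi> (c s x))"
proof
  fix s assume "s \<in> S"
  then have "C s x \<le> C s y \<longleftrightarrow> c s x \<le> c s y" if "x \<in> Ob" "y \<in> Ob" for x y
    using assms(6) that by (simp add: ordinally_sound_def)
  then obtain \<phi> where "strict_mono_on (c s ` Ob) \<phi>" "\<And>x. x \<in> Ob \<Longrightarrow> C s x = \<phi> (c s x)"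
    using order_equivalent_imp_strict_mono_factor[of Ob "C s" "c s"] by blast
  then show "\<exists>\<phi>. strict_mono_on (c s ` Ob) \<phi> \<and> (\<forall>x\<in>Ob. C s x = \<phi> (c s x))"
    by blast
qed

end
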